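(* Let $T$ be a subresiduated Nelson algebra. Let $\theta$ be the relation on $T$ given by $x\,\theta\,y$ if and only if $x\to y=1$ and $y\to x=1$, and let $T/\theta$ be the quotient subresiduated lattice. Then the map $\rho_T:T\to \mathrm{K}(T/\theta)$ given by $\rho_T(x)=(x/\theta,\ \sim x/\theta)$ is a monomorphism (that is, an injective homomorphism of subresiduated Nelson algebras).
   Context: A Kleene algebra is a bounded distributive lattice $\langle T,\wedge,\vee,0,1\rangle$ with a unary operation $\sim$ satisfying $\sim\sim x=x$, $\sim(x\wedge y)=\sim x\vee\sim y$, $(x\wedge\sim x)\wedge(y\vee\sim y)=x\wedge\sim x$. A subresiduated Nelson algebra is an algebra $\langle T,\wedge,\vee,\to,\sim,0,1\rangle$ of type $(2,2,2,1,0,0)$ such that $\langle T,\wedge,\vee,\sim,0,1\rangle$ is a Kleene algebra and for all $x,y,z\in T$: (1) $(x\vee y)\to z=(x\to z)\wedge(y\to z)$; (2) $z\to(x\wedge y)=(z\to x)\wedge(z\to y)$; (3) $((x\to y)\wedge(y\to z))\to(x\to z)=1$; (4) $x\to x=1$; (5) $x\wedge(x\to y)\le x\wedge(\sim x\vee y)$; (6) $x\to y\le z\to(x\to y)$; (7) $\sim(x\to y)\to(x\wedge\sim y)=1$; (8) $(x\wedge\sim y)\to\sim(x\to y)=1$. A subresiduated lattice (sr-lattice) is an algebra $\langle A,\wedge,\vee,\to,0,1\rangle$ of type $(2,2,2,0,0)$ such that $\langle A,\wedge,\vee,0,1\rangle$ is a bounded distributive lattice and for all $a,b,c\in A$: $(a\vee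 b)\to c=(a\to c)\wedge(b\to c)$; $c\to(a\wedge b)=(c\to a)\wedge(c\to b)$; $(a\to b)\wedge(b\to c)\le a\to c$; $a\to a=1$; $a\wedge(a\to b)\le b$; $a\to b\le c\to(a\to b)$. The relation $\theta$ is an equivalence relation compatible with $\wedge,\vee,\to$, and $T/\theta$ is an sr-lattice with the induced operations $x/\theta\wedge y/\theta=(x\wedge y)/\theta$, $x/\theta\vee y/\theta=(x\vee y)/\theta$, $x/\theta\to y/\theta=(x\to y)/\theta$, $0=0/\theta$, $1=1/\theta$. For an sr-lattice $A$, $\mathrm{K}(A)=\{(a,b)\in A\times A: a\wedge b=0\}$, with operations $(a,b)\wedge(c,d)=(a\wedge c,b\vee d)$, $(a,b)\vee(c,d)=(a\vee c,b\wedge d)$, $\sim(a,b)=(b,a)$, $(a,b)\Rightarrow(c,d)=(a\to c,a\wedge d)$ (playing the role of the implication), least element $(0,1)$ and greatest element $(1,0)$; it is a subresiduated Nelson algebra. *)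

theory Defs
  imports "HOL-Algebra.Congruence"
begin

record 'a lat_algebra = "'a partial_object" +
  meet :: "'a \<Rightarrow> 'a \<Rightarrow> 'a" (infixl "\<sqinter>\<index>" 70)
  join :: "'a \<Rightarrow> 'a \<Rightarrow> 'a" (infixl "\<squnion>\<index>" 65)
  bot_elt :: 'a ("\<zero>\<index>")
  top_elt :: 'a ("\<one>\<index>")

record 'a sr_algebra = "'a lat_algebra" +
  imp :: "'a \<Rightarrow> 'a \<Rightarrow> 'a" (infixr "\<leadsto>\<index>" 60)

record 'a sn_algebra = "'a sr_algebra" +
  neg :: "'a \<Rightarrow> 'a" ("\<sim>\<index> _" [81] 80)

definition lat_le :: "('a, 'm) lat_algebra_scheme \<Rightarrow> 'a \<Rightarrow> 'a \<Rightarrow> bool" (infix "\<sqsubseteq>\<index>" 50)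
  where "x \<sqsubseteq>\<^bsub>L\<^esub> y \<longleftrightarrow> x \<sqinter>\<^bsub>L\<^esub> y = x"

locale bounded_distrib_lattice =
  fixes L (structure)
  assumes meet_closed [intro, simp]:
      "\<lbrakk>x \<in> carrier L; y \<in> carrier L\<rbrakk> \<Longrightarrow> x \<sqinter> y \<in> carrier L"
    and join_closed [intro, simp]:
      "\<lbrakk>x \<in> carrier L; y \<in> carrier L\<rbrakk> \<Longrightarrow> x \<squnion> y \<in> carrier L"
    and bot_closed [intro, simp]: "\<zero> \<in> carrier L"
    and top_closed [intro, simp]: "\<one> \<in> carrier L"
    and meet_assoc:
      "\<lbrakk>x \<in> carrier L; y \<in> carrier L; z \<in> carrier L\<rbrakk> \<Longrightarrow> (x \<sqinter> y) \<sqinter> z = x \<sqinter> (y \<sqinter> z)"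
    and join_assoc:
      "\<lbrakk>x \<in> carrier L; y \<in> carrier L; z \<in> carrier L\<rbrakk> \<Longrightarrow> (x \<squnion> y) \<squnion> z = x \<squnion> (y \<squnion> z)"
    and meet_comm: "\<lbrakk>x \<in> carrier L; y \<in> carrier L\<rbrakk> \<Longrightarrow> x \<sqinter> y = y \<sqinter> x"
    and join_comm: "\<lbrakk>x \<in> carrier L; y \<in> carrier L\<rbrakk> \<Longrightarrow> x \<squnion> y = y \<squnion> x"
    and meet_join_absorb: "\<lbrakk>x \<in> carrier L; y \<in> carrier L\<rbrakk> \<Longrightarrow> x \<sqinter> (x \<squnion> y) = x"
    and join_meet_absorb: "\<lbrakk>x \<in> carrier L; y \<in> carrier L\<rbrakk> \<Longrightarrow> x \<squnion> (x \<sqinter> y) = x"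
    and meet_join_distrib:
      "\<lbrakk>x \<in> carrier L; y \<in> carrier L; z \<in> carrier L\<rbrakk>
        \<Longrightarrow> x \<sqinter> (y \<squnion> z) = (x \<sqinter> y) \<squnion> (x \<sqinter> z)"
    and bot_le: "x \<in> carrier L \<Longrightarrow> \<zero> \<sqsubseteq> x"
    and le_top: "x \<in> carrier L \<Longrightarrow> x \<sqsubseteq> \<one>"

locale sr_lattice = bounded_distrib_lattice A for A (structure) +
  assumes imp_closed [intro, simp]:
      "\<lbrakk>a \<in> carrier A; b \<in> carrier A\<rbrakk> \<Longrightarrow> a \<leadsto> b \<in> carrier A"
    and join_imp:
      "\<lbrakk>a \<in> carrier A; b \<in> carrier A; c \<in> carrier A\<rbrakk>
        \<Longrightarrow> (a \<squnion> b) \<leadsto> c = (a \<leadsto> c) \<sqinter> (b \<leadsto> c)"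
    and imp_meet:
      "\<lbrakk>a \<in> carrier A; b \<in> carrier A; c \<in> carrier A\<rbrakk>
        \<Longrightarrow> c \<leadsto> (a \<sqinter> b) = (c \<leadsto> a) \<sqinter> (c \<leadsto> b)"
    and imp_trans:
      "\<lbrakk>a \<in> carrier A; b \<in> carrier A; c \<in> carrier A\<rbrakk>
        \<Longrightarrow> (a \<leadsto> b) \<sqinter> (b \<leadsto> c) \<sqsubseteq> (a \<leadsto> c)"
    and imp_refl: "a \<in> carrier A \<Longrightarrow> a \<leadsto> a = \<one>"
    and meet_imp_le:
      "\<lbrakk>a \<in> carrier A; b \<in> carrier A\<rbrakk> \<Longrightarrow> a \<sqinter> (a \<leadsto> b) \<sqsubseteq> b"
    and imp_le_imp:
      "\<lbrakk>a \<in> carrier A; b \<in> carrier A; c \<in> carrier A\<rbrakk>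
        \<Longrightarrow> (a \<leadsto> b) \<sqsubseteq> (c \<leadsto> (a \<leadsto> b))"

locale kleene_algebra = bounded_distrib_lattice T for T (structure) +
  assumes neg_closed [intro, simp]: "x \<in> carrier T \<Longrightarrow> \<sim> x \<in> carrier T"
    and neg_neg: "x \<in> carrier T \<Longrightarrow> \<sim> (\<sim> x) = x"
    and neg_meet: "\<lbrakk>x \<in> carrier T; y \<in> carrier T\<rbrakk> \<Longrightarrow> \<sim> (x \<sqinter> y) = \<sim> x \<squnion> \<sim> y"
    and kleene:
      "\<lbrakk>x \<in> carrier T; y \<in> carrier T\<rbrakk>
        \<Longrightarrow> (x \<sqinter> \<sim> x) \<sqinter> (y \<squnion> \<sim> y) = x \<sqinter> \<sim> x"

locale sr_nelson_algebra = kleene_algebra T for T (structure) +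
  assumes imp_closed [intro, simp]:
      "\<lbrakk>x \<in> carrier T; y \<in> carrier T\<rbrakk> \<Longrightarrow> x \<leadsto> y \<in> carrier T"
    and join_imp:
      "\<lbrakk>x \<in> carrier T; y \<in> carrier T; z \<in> carrier T\<rbrakk>
        \<Longrightarrow> (x \<squnion> y) \<leadsto> z = (x \<leadsto> z) \<sqinter> (y \<leadsto> z)"
    and imp_meet:
      "\<lbrakk>x \<in> carrier T; y \<in> carrier T; z \<in> carrier T\<rbrakk>
        \<Longrightarrow> z \<leadsto> (x \<sqinter> y) = (z \<leadsto> x) \<sqinter> (z \<leadsto> y)"
    and imp_trans:
      "\<lbrakk>x \<in> carrier T; y \<in> carrier T; z \<in> carrier T\<rbrakk>
        \<Longrightarrow> ((x \<leadsto> y) \<sqinter> (y \<leadsto> z)) \<leadsto> (x \<leadsto> z) = \<one>"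
    and imp_refl: "x \<in> carrier T \<Longrightarrow> x \<leadsto> x = \<one>"
    and meet_imp_le:
      "\<lbrakk>x \<in> carrier T; y \<in> carrier T\<rbrakk>
        \<Longrightarrow> x \<sqinter> (x \<leadsto> y) \<sqsubseteq> x \<sqinter> (\<sim> x \<squnion> y)"
    and imp_le_imp:
      "\<lbrakk>x \<in> carrier T; y \<in> carrier T; z \<in> carrier T\<rbrakk>
        \<Longrightarrow> (x \<leadsto> y) \<sqsubseteq> (z \<leadsto> (x \<leadsto> y))"
    and neg_imp_imp_meet:
      "\<lbrakk>x \<in> carrier T; y \<in> carrier T\<rbrakk> \<Longrightarrow> \<sim> (x \<leadsto> y) \<leadsto> (x \<sqinter> \<sim> y) = \<one>"
    and meet_imp_neg_imp:
      "\<lbrakk>x \<in> carrier T; y \<in> carrier T\<rbrakk> \<Longrightarrow> (x \<sqinter> \<sim> y) \<leadsto> \<sim> (x \<leadsto> y) = \<one>"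

definition theta :: "('a, 'm) sr_algebra_scheme \<Rightarrow> ('a \<times> 'a) set"
  where "theta T = {(x, y). x \<in> carrier T \<and> y \<in> carrier T \<and>
                            x \<leadsto>\<^bsub>T\<^esub> y = \<one>\<^bsub>T\<^esub> \<and> y \<leadsto>\<^bsub>T\<^esub> x = \<one>\<^bsub>T\<^esub>}"

(* The unions over representatives collapse to a single class because theta is a
   congruence on a subresiduated Nelson algebra; see quotient_ops below. *)
definition quotient_sr :: "('a, 'm) sr_algebra_scheme \<Rightarrow> 'a set sr_algebra"
  where "quotient_sr T =
    \<lparr>carrier = carrier T // theta T,
     meet = (\<lambda>X Y. \<Union>x\<in>X. \<Union>y\<in>Y. theta T `` {x \<sqinter>\<^bsub>T\<^esub> y}),
     join = (\<lambda>X Y. \<Union>x\<in>X. \<Union>y\<in>Y. theta T `` {x \<squnion>\<^bsub>T\<^esub> y}),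
     bot_elt = theta T `` {\<zero>\<^bsub>T\<^esub>},
     top_elt = theta T `` {\<one>\<^bsub>T\<^esub>},
     imp = (\<lambda>X Y. \<Union>x\<in>X. \<Union>y\<in>Y. theta T `` {x \<leadsto>\<^bsub>T\<^esub> y})\<rparr>"

definition kalman :: "('a, 'm) sr_algebra_scheme \<Rightarrow> ('a \<times> 'a) sn_algebra"
  where "kalman A =
    \<lparr>carrier = {(a, b). a \<in> carrier A \<and> b \<in> carrier A \<and> a \<sqinter>\<^bsub>A\<^esub> b = \<zero>\<^bsub>A\<^esub>},
     meet = (\<lambda>(a, b) (c, d). (a \<sqinter>\<^bsub>A\<^esub> c, b \<squnion>\<^bsub>A\<^esub> d)),
     join = (\<lambda>(a, b) (c, d). (a \<squnion>\<^bsub>A\<^esub> c, b \<sqinter>\<^bsub>A\<^esub> d)),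
     bot_elt = (\<zero>\<^bsub>A\<^esub>, \<one>\<^bsub>A\<^esub>),
     top_elt = (\<one>\<^bsub>A\<^esub>, \<zero>\<^bsub>A\<^esub>),
     imp = (\<lambda>(a, b) (c, d). (a \<leadsto>\<^bsub>A\<^esub> c, a \<sqinter>\<^bsub>A\<^esub> d)),
     neg = (\<lambda>(a, b). (b, a))\<rparr>"

definition rho :: "('a, 'm) sn_algebra_scheme \<Rightarrow> 'a \<Rightarrow> 'a set \<times> 'a set"
  where "rho T x = (theta T `` {x}, theta T `` {\<sim>\<^bsub>T\<^esub> x})"

locale sr_nelson_hom =
  source: sr_nelson_algebra T + target: sr_nelson_algebra U
  for T :: "('a, 'm) sn_algebra_scheme" and U :: "('b, 'n) sn_algebra_scheme" +
  fixes h :: "'a \<Rightarrow> 'b"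
  assumes hom_closed: "x \<in> carrier T \<Longrightarrow> h x \<in> carrier U"
    and hom_meet:
      "\<lbrakk>x \<in> carrier T; y \<in> carrier T\<rbrakk> \<Longrightarrow> h (x \<sqinter>\<^bsub>T\<^esub> y) = h x \<sqinter>\<^bsub>U\<^esub> h y"
    and hom_join:
      "\<lbrakk>x \<in> carrier T; y \<in> carrier T\<rbrakk> \<Longrightarrow> h (x \<squnion>\<^bsub>T\<^esub> y) = h x \<squnion>\<^bsub>U\<^esub> h y"
    and hom_imp:
      "\<lbrakk>x \<in> carrier T; y \<in> carrier T\<rbrakk> \<Longrightarrow> h (x \<leadsto>\<^bsub>T\<^esub> y) = h x \<leadsto>\<^bsub>U\<^esub> h y"
    and hom_neg: "x \<in> carrier T \<Longrightarrow> h (\<sim>\<^bsub>T\<^esub> x) = \<sim>\<^bsub>U\<^esub> h x"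
    and hom_bot: "h \<zero>\<^bsub>T\<^esub> = \<zero>\<^bsub>U\<^esub>"
    and hom_top: "h \<one>\<^bsub>T\<^esub> = \<one>\<^bsub>U\<^esub>"

locale sr_nelson_mono = sr_nelson_hom +
  assumes inj: "inj_on h (carrier T)"

context bounded_distrib_lattice
begin

lemma meet_left_comm:
  "\<lbrakk>x \<in> carrier L; y \<in> carrier L; z \<in> carrier L\<rbrakk> \<Longrightarrow> x \<sqinter> (y \<sqinter> z) = y \<sqinter> (x \<sqinter> z)"
  by (metis meet_assoc meet_comm)

lemma join_left_comm:
  "\<lbrakk>x \<in> carrier L; y \<in> carrier L; z \<in> carrier L\<rbrakk> \<Longrightarrow> x \<squnion> (y \<squnion> z) = y \<squnion> (x \<squnion> z)"
  by (metis join_assoc join_comm)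

lemmas meet_ac = meet_assoc meet_comm meet_left_comm
lemmas join_ac = join_assoc join_comm join_left_comm

lemma meet_idem [simp]: "x \<in> carrier L \<Longrightarrow> x \<sqinter> x = x"
  by (metis meet_closed meet_join_absorb join_meet_absorb)

lemma join_idem [simp]: "x \<in> carrier L \<Longrightarrow> x \<squnion> x = x"
  by (metis meet_idem join_meet_absorb)

lemma meet_bot [simp]: "x \<in> carrier L \<Longrightarrow> \<zero> \<sqinter> x = \<zero>" "x \<in> carrier L \<Longrightarrow> x \<sqinter> \<zero> = \<zero>"
  using bot_le meet_comm by (auto simp: lat_le_def)

lemma meet_top [simp]: "x \<in> carrier L \<Longrightarrow> \<one> \<sqinter> x = x" "x \<in> carrier L \<Longrightarrow> x \<sqinter> \<one> = x"
  using le_top meet_comm by (auto simp: lat_le_def)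

lemma join_bot [simp]: "x \<in> carrier L \<Longrightarrow> \<zero> \<squnion> x = x" "x \<in> carrier L \<Longrightarrow> x \<squnion> \<zero> = x"
  by (metis bot_closed join_comm join_meet_absorb meet_bot(2))+

lemma join_top [simp]: "x \<in> carrier L \<Longrightarrow> \<one> \<squnion> x = \<one>" "x \<in> carrier L \<Longrightarrow> x \<squnion> \<one> = \<one>"
  by (metis top_closed join_comm join_meet_absorb meet_top(1))+

lemma join_meet_distrib:
  assumes "x \<in> carrier L" "y \<in> carrier L" "z \<in> carrier L"
  shows "x \<squnion> (y \<sqinter> z) = (x \<squnion> y) \<sqinter> (x \<squnion> z)"
proof -
  have "(x \<squnion> y) \<sqinter> (x \<squnion> z) = ((x \<squnion> y) \<sqinter> x) \<squnion> ((x \<squnion> y) \<sqinter> z)"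
    using assms by (simp add: meet_join_distrib)
  also have "\<dots> = x \<squnion> (z \<sqinter> (x \<squnion> y))"
    using assms by (metis join_closed meet_comm meet_join_absorb)
  also have "\<dots> = x \<squnion> ((x \<sqinter> z) \<squnion> (y \<sqinter> z))"
    using assms by (metis meet_join_distrib meet_comm)
  also have "\<dots> = x \<squnion> (y \<sqinter> z)"
    using assms by (metis join_assoc join_meet_absorb meet_closed)
  finally show ?thesis by simp
qed

lemma le_refl: "x \<in> carrier L \<Longrightarrow> x \<sqsubseteq> x"
  by (simp add: lat_le_def)

lemma le_trans:
  "\<lbrakk>x \<sqsubseteq> y; y \<sqsubseteq> z; x \<in> carrier L; y \<in> carrier L; z \<in> carrier L\<rbrakk> \<Longrightarrow> x \<sqsubseteq> z"
  by (metis lat_le_def meet_assoc)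

lemma meet_le1: "\<lbrakk>x \<in> carrier L; y \<in> carrier L\<rbrakk> \<Longrightarrow> x \<sqinter> y \<sqsubseteq> x"
  unfolding lat_le_def by (metis meet_assoc meet_comm meet_idem)

lemma meet_le2: "\<lbrakk>x \<in> carrier L; y \<in> carrier L\<rbrakk> \<Longrightarrow> x \<sqinter> y \<sqsubseteq> y"
  by (simp add: lat_le_def meet_ac)

lemma le_join1: "\<lbrakk>x \<in> carrier L; y \<in> carrier L\<rbrakk> \<Longrightarrow> x \<sqsubseteq> x \<squnion> y"
  by (simp add: lat_le_def meet_join_absorb)

lemma le_join2: "\<lbrakk>x \<in> carrier L; y \<in> carrier L\<rbrakk> \<Longrightarrow> y \<sqsubseteq> x \<squnion> y"
  by (metis lat_le_def meet_join_absorb join_comm)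

lemma le_meetI:
  "\<lbrakk>z \<sqsubseteq> x; z \<sqsubseteq> y; x \<in> carrier L; y \<in> carrier L; z \<in> carrier L\<rbrakk> \<Longrightarrow> z \<sqsubseteq> x \<sqinter> y"
  by (metis lat_le_def meet_assoc)

lemma meet_eq_top_iff:
  "\<lbrakk>x \<in> carrier L; y \<in> carrier L\<rbrakk> \<Longrightarrow> x \<sqinter> y = \<one> \<longleftrightarrow> x = \<one> \<and> y = \<one>"
  by (metis join_meet_absorb join_top(2) meet_comm meet_top(1) top_closed)

lemma le_meet_bot:
  "\<lbrakk>u \<sqsubseteq> c; c \<sqinter> d = \<zero>; u \<in> carrier L; c \<in> carrier L; d \<in> carrier L\<rbrakk> \<Longrightarrow> u \<sqinter> d = \<zero>"
  by (metis lat_le_def meet_assoc meet_bot(2))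

end

context kleene_algebra
begin

lemma neg_bot: "\<sim> \<zero> = \<one>"
  by (metis bot_closed join_top(2) meet_bot(1) neg_closed neg_meet neg_neg top_closed)

lemma neg_top: "\<sim> \<one> = \<zero>"
  using neg_bot neg_neg bot_closed by metis

end

context sr_nelson_algebra
begin

lemma le_imp_top: "\<lbrakk>x \<sqsubseteq> y; x \<in> carrier T; y \<in> carrier T\<rbrakk> \<Longrightarrow> x \<leadsto> y = \<one>"
  by (metis imp_closed imp_meet imp_refl lat_le_def meet_top(1))

lemma top_imp_eq_top:
  assumes a: "a \<in> carrier T" and "\<one> \<leadsto> a = \<one>"
  shows "a = \<one>"
  using meet_imp_le[OF top_closed a] assms by (simp add: lat_le_def neg_top)

lemma imp_top_trans:
  assumes "x \<leadsto> y = \<one>" "y \<leadsto> z = \<one>" "x \<in> carrier T" "y \<in> carrier T" "z \<in> carrier T"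
  shows "x \<leadsto> z = \<one>"
proof (rule top_imp_eq_top)
  show "x \<leadsto> z \<in> carrier T" using assms(3,5) by (rule imp_closed)
  show "\<one> \<leadsto> (x \<leadsto> z) = \<one>"
    using imp_trans[OF assms(3,4,5)] unfolding assms(1,2) by simp
qed

lemma imp_meet_top_iff:
  "\<lbrakk>x \<in> carrier T; y \<in> carrier T; z \<in> carrier T\<rbrakk>
    \<Longrightarrow> z \<leadsto> (x \<sqinter> y) = \<one> \<longleftrightarrow> z \<leadsto> x = \<one> \<and> z \<leadsto> y = \<one>"
  by (simp add: imp_meet meet_eq_top_iff)

lemma join_imp_top_iff:
  "\<lbrakk>x \<in> carrier T; y \<in> carrier T; z \<in> carrier T\<rbrakk>
    \<Longrightarrow> (x \<squnion> y) \<leadsto> z = \<one> \<longleftrightarrow> x \<leadsto> z = \<one> \<and> y \<leadsto> z = \<one>"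
  by (simp add: join_imp meet_eq_top_iff)

lemma meet_imp_top1: "\<lbrakk>x \<in> carrier T; y \<in> carrier T\<rbrakk> \<Longrightarrow> (x \<sqinter> y) \<leadsto> x = \<one>"
  by (simp add: le_imp_top meet_le1)

lemma meet_imp_top2: "\<lbrakk>x \<in> carrier T; y \<in> carrier T\<rbrakk> \<Longrightarrow> (x \<sqinter> y) \<leadsto> y = \<one>"
  by (simp add: le_imp_top meet_le2)

lemma imp_join_top1: "\<lbrakk>x \<in> carrier T; y \<in> carrier T\<rbrakk> \<Longrightarrow> x \<leadsto> (x \<squnion> y) = \<one>"
  by (simp add: le_imp_top le_join1)

lemma imp_join_top2: "\<lbrakk>x \<in> carrier T; y \<in> carrier T\<rbrakk> \<Longrightarrow> y \<leadsto> (x \<squnion> y) = \<one>"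
  by (simp add: le_imp_top le_join2)

lemma meet_mono:
  assumes "x \<leadsto> x' = \<one>" "y \<leadsto> y' = \<one>"
    and c: "x \<in> carrier T" "x' \<in> carrier T" "y \<in> carrier T" "y' \<in> carrier T"
  shows "(x \<sqinter> y) \<leadsto> (x' \<sqinter> y') = \<one>"
proof -
  have "(x \<sqinter> y) \<leadsto> x' = \<one>"
    by (rule imp_top_trans[OF meet_imp_top1]) (fact assms | simp add: c)+
  moreover have "(x \<sqinter> y) \<leadsto> y' = \<one>"
    by (rule imp_top_trans[OF meet_imp_top2]) (fact assms | simp add: c)+
  ultimately show ?thesis using c by (simp add: imp_meet_top_iff)
qed

lemma join_mono:
  assumes "x \<leadsto> x' = \<one>" "y \<leadsto> y' = \<one>"
    and c: "x \<in> carrier T" "x' \<in> carrier T" "y \<in> carrier T" "y' \<in> carrier T"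
  shows "(x \<squnion> y) \<leadsto> (x' \<squnion> y') = \<one>"
proof -
  have "x \<leadsto> (x' \<squnion> y') = \<one>"
    by (rule imp_top_trans[OF _ imp_join_top1]) (fact assms | simp add: c)+
  moreover have "y \<leadsto> (x' \<squnion> y') = \<one>"
    by (rule imp_top_trans[OF _ imp_join_top2]) (fact assms | simp add: c)+
  ultimately show ?thesis using c by (simp add: join_imp_top_iff)
qed

lemma imp_mono:
  assumes xx: "x' \<leadsto> x = \<one>" and yy: "y \<leadsto> y' = \<one>"
    and c: "x \<in> carrier T" "x' \<in> carrier T" "y \<in> carrier T" "y' \<in> carrier T"
  shows "(x \<leadsto> y) \<leadsto> (x' \<leadsto> y') = \<one>"
proof (rule imp_top_trans)
  show "(x \<leadsto> y) \<leadsto> (x' \<leadsto> y) = \<one>"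
    using imp_trans[OF c(2,1,3)] c by (simp add: xx)
  show "(x' \<leadsto> y) \<leadsto> (x' \<leadsto> y') = \<one>"
    using imp_trans[OF c(2,3,4)] c by (simp add: yy)
qed (simp_all add: c)

lemma meet_neg_imp:
  assumes x: "x \<in> carrier T" and y: "y \<in> carrier T"
  shows "(x \<sqinter> \<sim> x) \<leadsto> y = \<one>"
proof -
  have "(x \<sqinter> \<sim> x) \<leadsto> \<zero> = \<one>"
    using meet_imp_neg_imp[OF x x] x by (simp add: imp_refl neg_top)
  moreover have "\<zero> \<leadsto> y = \<one>" using y by (simp add: bot_le le_imp_top)
  ultimately show ?thesis by (rule imp_top_trans) (simp_all add: x y)
qed

lemma meet_imp_imp:
  assumes x: "x \<in> carrier T" and y: "y \<in> carrier T"
  shows "(x \<sqinter> (x \<leadsto> y)) \<leadsto> y = \<one>"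
proof -
  have "(x \<sqinter> (x \<leadsto> y)) \<leadsto> (x \<sqinter> (\<sim> x \<squnion> y)) = \<one>"
    using meet_imp_le[OF x y] x y by (simp add: le_imp_top)
  moreover have "(x \<sqinter> (\<sim> x \<squnion> y)) \<leadsto> y = \<one>"
    using x y by (simp add: meet_join_distrib join_imp_top_iff meet_neg_imp meet_imp_top2)
  ultimately show ?thesis by (rule imp_top_trans) (simp_all add: x y)
qed

lemma theta_iff:
  "(x, y) \<in> theta T \<longleftrightarrow> x \<in> carrier T \<and> y \<in> carrier T \<and> x \<leadsto> y = \<one> \<and> y \<leadsto> x = \<one>"
  by (simp add: theta_def)

lemma theta_equiv: "equiv (carrier T) (theta T)"
proof (rule equivI)
  show "theta T \<subseteq> carrier T \<times> carrier T" by (auto simp: theta_iff)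
  show "refl_on (carrier T) (theta T)" by (auto simp: refl_on_def theta_iff imp_refl)
  show "sym (theta T)" by (auto simp: sym_def theta_iff)
  show "trans (theta T)" by (auto simp: trans_def theta_iff intro: imp_top_trans)
qed

lemma theta_meet: "(\<lambda>x y. theta T `` {x \<sqinter> y}) respects2 theta T"
  by (auto intro!: congruent2I' equiv_class_eq[OF theta_equiv] simp: theta_iff meet_mono)

lemma theta_join: "(\<lambda>x y. theta T `` {x \<squnion> y}) respects2 theta T"
  by (auto intro!: congruent2I' equiv_class_eq[OF theta_equiv] simp: theta_iff join_mono)

lemma theta_imp: "(\<lambda>x y. theta T `` {x \<leadsto> y}) respects2 theta T"
  by (auto intro!: congruent2I' equiv_class_eq[OF theta_equiv] simp: theta_iff imp_mono)

lemma quotient_ops: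
  "carrier (quotient_sr T) = (\<lambda>x. theta T `` {x}) ` carrier T"
  "\<zero>\<^bsub>quotient_sr T\<^esub> = theta T `` {\<zero>}"
  "\<one>\<^bsub>quotient_sr T\<^esub> = theta T `` {\<one>}"
  "\<lbrakk>x \<in> carrier T; y \<in> carrier T\<rbrakk>
    \<Longrightarrow> theta T `` {x} \<sqinter>\<^bsub>quotient_sr T\<^esub> theta T `` {y} = theta T `` {x \<sqinter> y}"
  "\<lbrakk>x \<in> carrier T; y \<in> carrier T\<rbrakk>
    \<Longrightarrow> theta T `` {x} \<squnion>\<^bsub>quotient_sr T\<^esub> theta T `` {y} = theta T `` {x \<squnion> y}"
  "\<lbrakk>x \<in> carrier T; y \<in> carrier T\<rbrakk>
    \<Longrightarrow> theta T `` {x} \<leadsto>\<^bsub>quotient_sr T\<^esub> theta T `` {y} = theta T `` {x \<leadsto> y}"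
  by (auto simp: quotient_sr_def quotient_def
      UN_equiv_class2[OF theta_equiv theta_equiv theta_meet]
      UN_equiv_class2[OF theta_equiv theta_equiv theta_join]
      UN_equiv_class2[OF theta_equiv theta_equiv theta_imp])

lemma quotient_le_iff:
  assumes "x \<in> carrier T" "y \<in> carrier T"
  shows "theta T `` {x} \<sqsubseteq>\<^bsub>quotient_sr T\<^esub> theta T `` {y} \<longleftrightarrow> x \<leadsto> y = \<one>"
  using assms
  by (simp add: lat_le_def quotient_ops eq_equiv_class_iff[OF theta_equiv] theta_iff
      meet_imp_top1 imp_meet_top_iff imp_refl)

theorem quotient_sr_lattice: "sr_lattice (quotient_sr T)"
  by (unfold_locales,
    auto simp: quotient_ops quotient_le_iff meet_assoc join_assoc meet_join_absorb
      join_meet_absorb meet_join_distrib bot_le le_top le_imp_top join_imp imp_meet imp_trans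
      imp_refl meet_imp_imp imp_le_imp,
      (metis meet_comm join_comm)+)

end

context sr_lattice
begin

lemma le_imp_top: "\<lbrakk>x \<sqsubseteq> y; x \<in> carrier A; y \<in> carrier A\<rbrakk> \<Longrightarrow> x \<leadsto> y = \<one>"
  by (metis imp_closed imp_meet imp_refl lat_le_def meet_top(1))

lemma meet_imp_bot:
  assumes "a \<in> carrier A" "c \<in> carrier A" "d \<in> carrier A" "c \<sqinter> d = \<zero>"
  shows "(a \<leadsto> c) \<sqinter> (a \<sqinter> d) = \<zero>"
proof -
  have "(a \<sqinter> (a \<leadsto> c)) \<sqinter> d = \<zero>"
    by (rule le_meet_bot[OF meet_imp_le]) (use assms in auto)
  thus ?thesis using assms by (simp add: meet_ac)
qed

lemma meet_eq_bot_sub: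
  assumes "a \<in> carrier A" "b \<in> carrier A" "c \<in> carrier A" "a \<sqinter> b = \<zero>"
  shows "(a \<sqinter> c) \<sqinter> b = \<zero>" "(c \<sqinter> a) \<sqinter> b = \<zero>"
        "a \<sqinter> (b \<sqinter> c) = \<zero>" "a \<sqinter> (c \<sqinter> b) = \<zero>"
  using assms by (metis meet_assoc meet_comm meet_bot meet_closed)+

lemma imp_trans_meet_bot:
  assumes "a \<in> carrier A" "c \<in> carrier A" "e \<in> carrier A" "f \<in> carrier A" "e \<sqinter> f = \<zero>"
  shows "((a \<leadsto> c) \<sqinter> (c \<leadsto> e)) \<sqinter> (a \<sqinter> f) = \<zero>"
  by (rule le_meet_bot[OF imp_trans meet_imp_bot]) (use assms in auto)

lemma kalman_carrier_iff:
  "(a, b) \<in> carrier (kalman A) \<longleftrightarrow>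
    a \<in> carrier A \<and> b \<in> carrier A \<and> a \<sqinter> b = \<zero> \<and> b \<sqinter> a = \<zero>"
  using meet_comm by (auto simp: kalman_def)

lemma kalman_ops:
  "(a, b) \<sqinter>\<^bsub>kalman A\<^esub> (c, d) = (a \<sqinter> c, b \<squnion> d)"
  "(a, b) \<squnion>\<^bsub>kalman A\<^esub> (c, d) = (a \<squnion> c, b \<sqinter> d)"
  "(a, b) \<leadsto>\<^bsub>kalman A\<^esub> (c, d) = (a \<leadsto> c, a \<sqinter> d)"
  "\<sim>\<^bsub>kalman A\<^esub> (a, b) = (b, a)"
  "\<zero>\<^bsub>kalman A\<^esub> = (\<zero>, \<one>)"
  "\<one>\<^bsub>kalman A\<^esub> = (\<one>, \<zero>)"
  by (simp_all add: kalman_def)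

lemma kalman_le_iff:
  assumes "a \<in> carrier A" "b \<in> carrier A" "c \<in> carrier A" "d \<in> carrier A"
  shows "(a, b) \<sqsubseteq>\<^bsub>kalman A\<^esub> (c, d) \<longleftrightarrow> a \<sqsubseteq> c \<and> d \<sqsubseteq> b"
proof -
  have "b \<squnion> d = b \<longleftrightarrow> d \<sqinter> b = d"
    using assms by (metis join_comm join_meet_absorb meet_comm meet_join_absorb)
  thus ?thesis unfolding lat_le_def kalman_ops by simp
qed

lemma meet_join_bot:
  assumes "a \<in> carrier A" "b \<in> carrier A" "c \<in> carrier A" "d \<in> carrier A"
    and "a \<sqinter> b = \<zero>" "c \<sqinter> d = \<zero>"
  shows "(a \<sqinter> c) \<sqinter> (b \<squnion> d) = \<zero>" "(a \<squnion> c) \<sqinter> (b \<sqinter> d) = \<zero>"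
proof -
  show "(a \<sqinter> c) \<sqinter> (b \<squnion> d) = \<zero>"
    using assms by (simp add: meet_join_distrib meet_eq_bot_sub)
  have "(b \<sqinter> d) \<sqinter> (a \<squnion> c) = \<zero>"
    using assms by (simp add: meet_join_distrib meet_eq_bot_sub meet_comm[of b a] meet_comm[of d c])
  thus "(a \<squnion> c) \<sqinter> (b \<sqinter> d) = \<zero>"
    using assms by (metis join_closed meet_closed meet_comm)
qed

lemma meet_imp_bot2:
  assumes "a \<in> carrier A" "c \<in> carrier A" "d \<in> carrier A" "c \<sqinter> d = \<zero>"
  shows "(a \<sqinter> d) \<sqinter> (a \<leadsto> c) = \<zero>"
  using meet_imp_bot[OF assms] assms by (metis imp_closed meet_closed meet_comm)

lemma meet_imp_le_meet_join:
  assumes "a \<in> carrier A" "b \<in> carrier A" "c \<in> carrier A"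
  shows "a \<sqinter> (a \<leadsto> c) \<sqsubseteq> a \<sqinter> (b \<squnion> c)"
  using assms
  by (intro le_meetI meet_le1 le_trans[OF meet_imp_le le_join2]) auto

lemma meet_join_distrib2:
  "\<lbrakk>x \<in> carrier A; y \<in> carrier A; z \<in> carrier A\<rbrakk>
    \<Longrightarrow> (x \<squnion> y) \<sqinter> z = (x \<sqinter> z) \<squnion> (y \<sqinter> z)"
  by (metis join_closed meet_comm meet_join_distrib)

theorem kalman_sr_nelson_algebra: "sr_nelson_algebra (kalman A)"
  by unfold_locales
    (auto simp: split_paired_all kalman_carrier_iff kalman_ops kalman_le_iff meet_join_bot
      meet_join_absorb join_meet_absorb join_imp imp_meet imp_refl bot_le le_top imp_le_imp
      le_refl le_imp_top imp_trans imp_trans_meet_bot meet_imp_bot meet_imp_bot2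
      meet_imp_le_meet_join meet_le2
      intro: meet_comm join_comm meet_assoc join_assoc
        meet_join_distrib meet_join_distrib2 join_meet_distrib)

end

end

theory Submission
  imports Defs
begin

text \<open>
  Every homomorphism law is an identity between classes in the quotient, checked in each of the two
  components. The first component is compatible with meet, join and implication because
  \<open>theta T\<close> is a congruence for these operations. In the second component meet and join are
  handled by the De Morgan laws, and implication by the two axioms saying that
  \<open>\<sim> (x \<leadsto> y)\<close> and \<open>x \<sqinter> \<sim> y\<close> imply each other. A pair \<open>rho T x\<close> lies in
  \<open>kalman (quotient_sr T)\<close> because \<open>x \<sqinter> \<sim> x\<close> implies every element, hence is equivalent to
  \<open>\<zero>\<close>.

  The relation \<open>theta T\<close> alone identifies too much, since it need not respect negation.
  Injectivity means that the class of \<open>x\<close> together with that of \<open>\<sim> x\<close> determines \<open>x\<close>; this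
  follows from the criterion for the order in \<open>le_of_imp_top_of_neg_imp_top\<close>, where the Kleene
  inequality enters, applied in both directions.
\<close>

context kleene_algebra
begin

lemma neg_join:
  assumes "x \<in> carrier T" "y \<in> carrier T"
  shows "\<sim> (x \<squnion> y) = \<sim> x \<sqinter> \<sim> y"
  using arg_cong[OF neg_meet[of "\<sim> x" "\<sim> y"], of "neg T"] assms by (simp add: neg_neg)

lemma neg_antimono:
  assumes "x \<sqsubseteq> y" and c: "x \<in> carrier T" "y \<in> carrier T"
  shows "\<sim> y \<sqsubseteq> \<sim> x"
proof -
  have "\<sim> x = \<sim> y \<squnion> \<sim> x"
    using assms neg_meet[OF c] by (simp add: lat_le_def join_comm)
  thus ?thesis using le_join1[of "\<sim> y" "\<sim> x"] c by simp
qed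

end

context bounded_distrib_lattice
begin

lemma le_antisym:
  "\<lbrakk>x \<sqsubseteq> y; y \<sqsubseteq> x; x \<in> carrier L; y \<in> carrier L\<rbrakk> \<Longrightarrow> x = y"
  by (metis lat_le_def meet_comm)

lemma join_leI:
  assumes "x \<sqsubseteq> z" "y \<sqsubseteq> z" and c: "x \<in> carrier L" "y \<in> carrier L" "z \<in> carrier L"
  shows "x \<squnion> y \<sqsubseteq> z"
proof -
  have "z \<sqinter> (x \<squnion> y) = x \<squnion> y"
    using assms by (simp add: lat_le_def meet_join_distrib meet_comm[of z])
  thus ?thesis using c by (simp add: lat_le_def meet_comm)
qed

text \<open>
  Distributivity is what allows an element below a join to be compared piecewise: it is the join of
  its meets with the two joinands.
\<close>

lemma le_of_le_join:
  assumes "u \<sqsubseteq> a \<squnion> b" "u \<sqinter> a \<sqsubseteq> z" "u \<sqinter> b \<sqsubseteq> z"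
    and "u \<in> carrier L" "a \<in> carrier L" "b \<in> carrier L" "z \<in> carrier L"
  shows "u \<sqsubseteq> z"
proof -
  have "(u \<sqinter> a) \<squnion> (u \<sqinter> b) \<sqsubseteq> z"
    using assms by (intro join_leI) auto
  moreover have "(u \<sqinter> a) \<squnion> (u \<sqinter> b) = u"
    using assms(1) meet_join_distrib[OF assms(4-6)] by (simp add: lat_le_def)
  ultimately show ?thesis by simp
qed

end

context sr_nelson_algebra
begin

lemma le_neg_join_of_imp_top:
  assumes "x \<leadsto> y = \<one>" and c: "x \<in> carrier T" "y \<in> carrier T"
  shows "x \<sqsubseteq> \<sim> x \<squnion> y"
proof -
  have "x \<sqsubseteq> x \<sqinter> (\<sim> x \<squnion> y)" using meet_imp_le[OF c] assms by simp
  thus ?thesis by (rule le_trans[OF _ meet_le2]) (use c in auto)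
qed

text \<open>
  An implication with value \<open>\<one>\<close> only yields \<open>x \<sqsubseteq> \<sim> x \<squnion> y\<close>, so the part \<open>x \<sqinter> \<sim> x\<close> of \<open>x\<close> has to
  be brought below \<open>y\<close> by other means. The Kleene inequality puts it below \<open>y \<squnion> \<sim> y\<close>, and the
  contrapositive implication, negated, gives \<open>x \<sqinter> \<sim> y \<sqsubseteq> y\<close>, which absorbs the part below \<open>\<sim> y\<close>.
\<close>

lemma le_of_imp_top_of_neg_imp_top:
  assumes xy: "x \<leadsto> y = \<one>" and nyx: "\<sim> y \<leadsto> \<sim> x = \<one>"
    and c: "x \<in> carrier T" "y \<in> carrier T"
  shows "x \<sqsubseteq> y"
proof -
  have "\<sim> y \<sqsubseteq> y \<squnion> \<sim> x"
    using le_neg_join_of_imp_top[OF nyx] c by (simp add: neg_neg)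
  hence "\<sim> (y \<squnion> \<sim> x) \<sqsubseteq> \<sim> (\<sim> y)"
    using c by (intro neg_antimono) auto
  hence meet_ny: "x \<sqinter> \<sim> y \<sqsubseteq> y"
    using c by (simp add: neg_join neg_neg meet_comm)
  have "x \<sqinter> \<sim> x \<sqsubseteq> y"
  proof (rule le_of_le_join)
    show "x \<sqinter> \<sim> x \<sqsubseteq> y \<squnion> \<sim> y" using kleene[OF c] by (simp add: lat_le_def)
    show "(x \<sqinter> \<sim> x) \<sqinter> y \<sqsubseteq> y" using c by (simp add: meet_le2)
    have "(x \<sqinter> \<sim> x) \<sqinter> \<sim> y = \<sim> x \<sqinter> (x \<sqinter> \<sim> y)" using c by (simp add: meet_ac)
    also have "\<dots> \<sqsubseteq> y"
      using c by (intro le_trans[OF meet_le2 meet_ny]) auto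
    finally show "(x \<sqinter> \<sim> x) \<sqinter> \<sim> y \<sqsubseteq> y" .
  qed (use c in auto)
  with le_neg_join_of_imp_top[OF xy c] show ?thesis
    by (rule le_of_le_join) (use c in \<open>auto simp: meet_le2\<close>)
qed

lemma theta_class_eq_iff:
  assumes "x \<in> carrier T" "y \<in> carrier T"
  shows "theta T `` {x} = theta T `` {y} \<longleftrightarrow> x \<leadsto> y = \<one> \<and> y \<leadsto> x = \<one>"
  using assms by (simp add: eq_equiv_class_iff[OF theta_equiv] theta_iff)

lemma inj_on_rho: "inj_on (rho T) (carrier T)"
proof (rule inj_onI)
  fix x y assume c: "x \<in> carrier T" "y \<in> carrier T" and "rho T x = rho T y"
  hence "x \<leadsto> y = \<one>" "y \<leadsto> x = \<one>" "\<sim> x \<leadsto> \<sim> y = \<one>" "\<sim> y \<leadsto> \<sim> x = \<one>"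
    by (simp_all add: rho_def theta_class_eq_iff)
  hence "x \<sqsubseteq> y" "y \<sqsubseteq> x" using c by (simp_all add: le_of_imp_top_of_neg_imp_top)
  thus "x = y" using c by (rule le_antisym)
qed

lemma theta_class_meet_neg:
  assumes "x \<in> carrier T"
  shows "theta T `` {x \<sqinter> \<sim> x} = theta T `` {\<zero>}"
  using assms by (simp add: theta_class_eq_iff meet_neg_imp bot_le le_imp_top)

lemma theta_class_neg_imp:
  assumes "x \<in> carrier T" "y \<in> carrier T"
  shows "theta T `` {\<sim> (x \<leadsto> y)} = theta T `` {x \<sqinter> \<sim> y}"
  using assms by (simp add: theta_class_eq_iff neg_imp_imp_meet meet_imp_neg_imp)

end

theorem theorem3p7:
  fixes T :: "('a, 'm) sn_algebra_scheme"
  assumes "sr_nelson_algebra T"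
  shows "sr_nelson_mono T (kalman (quotient_sr T)) (rho T)"
proof -
  interpret T: sr_nelson_algebra T by fact
  interpret Q: sr_lattice "quotient_sr T" by (rule T.quotient_sr_lattice)
  interpret K: sr_nelson_algebra "kalman (quotient_sr T)" by (rule Q.kalman_sr_nelson_algebra)
  show ?thesis
  proof unfold_locales
    fix x assume x: "x \<in> carrier T"
    have "theta T `` {\<sim>\<^bsub>T\<^esub> x \<sqinter>\<^bsub>T\<^esub> x} = theta T `` {\<zero>\<^bsub>T\<^esub>}"
      using T.theta_class_meet_neg[OF x] x by (simp add: T.meet_comm)
    with x show "rho T x \<in> carrier (kalman (quotient_sr T))"
      by (simp add: rho_def Q.kalman_carrier_iff T.quotient_ops T.theta_class_meet_neg)
  qed (simp_all add: rho_def Q.kalman_ops T.quotient_ops T.neg_meet T.neg_join T.neg_neg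
      T.theta_class_neg_imp T.neg_bot T.neg_top T.inj_on_rho)
qed

end
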